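(* Let $m,n$ be positive integers with $m<n$, let $a_k>0$ for $k\in[n-m]$, and let $A=\operatorname{diag}(a_1,\ldots,a_{n-m},0,\ldots,0)\in\mathbb{R}^{n\times n}$. Let $B$ be a real symmetric $n\times n$ matrix partitioned as $$B=\begin{pmatrix}B_{11}&B_{21}^T\\ B_{21}&B_{22}\end{pmatrix},\qquad B_{11}\in\mathbb{R}^{(n-m)\times(n-m)},\ B_{21}=\begin{pmatrix}b_1&\cdots&b_{n-m}\end{pmatrix}\in\mathbb{R}^{m\times(n-m)},\ B_{22}\in\mathbb{R}^{m\times m}.$$ Let $r=\operatorname{rank}B_{22}$ and write $B_{22}=CDC^T$ with $C=\begin{pmatrix}c_1&\cdots&c_r\end{pmatrix}\in\mathbb{R}^{m\times r}$ and $D=\operatorname{diag}(u_1,\ldots,u_r)$, $u_k\in\mathbb{R}\setminus\{0\}$ for $k\in[r]$. For $\gamma=(\gamma_1,\gamma_2)$ let $d_\gamma$ be the coefficient of $t^{\gamma_1}x^{\gamma_2}$ in $p_{A+tB}(x)=\det(xI-A-tB)$. Then: (i) If $\gamma=(0,n)+\eta(0,-1)$ with $\eta=0,\ldots,n-m$, then $d_\gamma=(-1)^{\eta}\sum_{\eta\times\eta}|A|$. (ii) If $\gamma=(0,m)+\eta(1,-1)$ with $\eta=1,\ldots,r$, then $$d_\gamma=(-1)^{n-m+\eta}\,a_1\cdots a_{n-m}\sum_{\eta\times\eta}|B_{22}|.$$ (iii) If $r>0$ and $\gamma=(r,m-r)+\mu(2,-1)$ with $\mu=1,\ldots,\min\{m-r,n-m\}$,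 then $$d_\gamma=(-1)^{n-m+r+2\mu}\,u_1\cdots u_r\sum_{\{k_1,\ldots,k_\mu\}\subset[n-m]}\ \prod_{k\in[n-m]\setminus\{k_1,\ldots,k_\mu\}}a_k\ \sum_{(r+\mu)\times(r+\mu)}\begin{vmatrix}b_{k_1}&\cdots&b_{k_\mu}&c_1&\cdots&c_r\end{vmatrix}^2,$$ where the outer sum is over all $\mu$-element subsets of $[n-m]$. If $r=0$, the same equality holds with $u_1\cdots u_r$ replaced by $1$ (and no columns $c_i$). (iv) If $\gamma=(r,m-r)+\eta(1,-1)+\mu(2,-1)$ with $\mu=0,\ldots,\min\{m-r,n-m\}-1$ and $\eta=1,\ldots,m-r-\mu$, then $d_\gamma=0$.
   Context: $[n]=\{1,\ldots,n\}$. For a square matrix $X$, $\sum_{d\times d}|X|$ denotes the sum of all $d\times d$ principal minors of $X$, with $\sum_{0\times0}|X|=1$. For a $p\times q$ matrix $X$ and $N=\min\{p,q\}$, $\sum_{N\times N}|X|^2$ denotes the sum of the squares of all $N\times N$ minors of $X$; here it is applied to the $m\times(r+\mu)$ matrix with columns $b_{k_1},\ldots,b_{k_\mu},c_1,\ldots,c_r$, where $r+\mu\le m$. Empty products equal $1$. When $r=0$, $B_{22}=O$. *)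

theory Defs
  imports Jordan_Normal_Form.Char_Poly Jordan_Normal_Form.DL_Rank Jordan_Normal_Form.DL_Submatrix
begin

(* Matrix rows and columns, and the families a, u and b_k = col B21 k, are indexed from 0,
   so the index set [N] = {1, ..., N} becomes {..<N}. *)

definition sum_principal_minors :: "nat \<Rightarrow> real mat \<Rightarrow> real" where
  "sum_principal_minors d X =
     (\<Sum>S | S \<subseteq> {..<dim_row X} \<and> card S = d. det (submatrix X S S))"

definition sum_squared_minors :: "nat \<Rightarrow> real mat \<Rightarrow> real" where
  "sum_squared_minors N X =
     (\<Sum>(I, J) \<in> {I. I \<subseteq> {..<dim_row X} \<and> card I = N} \<times> {J. J \<subseteq> {..<dim_col X} \<and> card J = N}.
        (det (submatrix X I J))\<^sup>2)"

(* det (x I - A - t B) as an element of R[t][x]: the coefficients of the outer polynomial in x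
   are polynomials in t, and [:0, 1:] below is the indeterminate t. *)
definition pencil_char_poly :: "real mat \<Rightarrow> real mat \<Rightarrow> real poly poly" where
  "pencil_char_poly A B =
     char_poly (map_mat (\<lambda>c. [:c:]) A + [:0, 1:] \<cdot>\<^sub>m map_mat (\<lambda>c. [:c:]) B)"

(* The coefficient of t^(fst \<gamma>) x^(snd \<gamma>). *)
definition pencil_coeff :: "real mat \<Rightarrow> real mat \<Rightarrow> nat \<times> nat \<Rightarrow> real" where
  "pencil_coeff A B \<gamma> = coeff (coeff (pencil_char_poly A B) (snd \<gamma>)) (fst \<gamma>)"

end

theory Submission
  imports Defs
begin

text \<open>Expanding \<open>det (x I - A - t B)\<close> along the diagonal part \<open>x I - A\<close> expresses each coefficient
  through principal minors of \<open>B\<close>. Put \<open>p = n - m\<close>. The coefficient of \<open>t^j x^e\<close> is, up to sign,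
  the sum over all subsets \<open>K\<close> of the first \<open>p\<close> indices with \<open>|K| = j + e - m\<close> of the product of the
  \<open>a k\<close> with \<open>k \<notin> K\<close>, times the sum of the principal minors of \<open>B\<close> of size \<open>j\<close> whose index sets \<open>S\<close>
  lie in \<open>K\<close> together with the last \<open>m\<close> indices (lemma \<open>pencil_coeff_degenerate_diagonal\<close>). For
  \<open>j = 0\<close> only the \<open>a k\<close> are left, and for \<open>K\<close> empty only principal minors of \<open>B22\<close>.

  The other two families rest on one determinant (lemma \<open>det_saddle\<close>). If \<open>S\<close> meets the first block in
  \<open>L\<close> and the last block in \<open>I\<close>, then the principal minor on \<open>S\<close> is the determinant of a matrix
  \<open>(P, Q\<^sup>T; Q, C D C\<^sup>T)\<close> with \<open>|L|\<close> rows on top and \<open>|I|\<close> rows below. Its lower rows depend on \<open>(Q, C)\<close>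
  only, which has \<open>|L| + r\<close> columns, and factoring \<open>(Q, C)\<close> out on both sides gives zero when
  \<open>|I| > |L| + r\<close>, and \<open>(-1)^|L| u\<^sub>1 \<cdots> u\<^sub>r det (Q, C)\<^sup>2\<close> when \<open>|I| = |L| + r\<close>. Equivalently, the minor
  vanishes as soon as \<open>|S| > r + 2 |L|\<close>. Since \<open>|L| \<le> |K|\<close>, nothing survives for \<open>j > r + 2 |K|\<close>;
  and for \<open>j = r + 2 |K|\<close> only the sets with \<open>L = K\<close> do, contributing the squared minors of the
  matrix with columns \<open>b\<^sub>k\<close>, \<open>k \<in> K\<close>, followed by the columns of \<open>C\<close>.\<close>

section \<open>Determinants over finite index sets\<close>

text \<open>The Leibniz formula with an arbitrary finite index set in place of an initial segment. A principal
  minor, the determinant of a submatrix whose rows and columns carry the same indices, then needs no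
  enumeration of its index set, and can be computed along whichever enumeration is convenient.\<close>

definition det_on :: "nat set \<Rightarrow> (nat \<Rightarrow> nat \<Rightarrow> 'a :: comm_ring_1) \<Rightarrow> 'a" where
  "det_on S F = (\<Sum>p | p permutes S. signof p * (\<Prod>i\<in>S. F i (p i)))"

lemma det_mat_eq_det_on: "det (mat N N (\<lambda>(i, j). F i j)) = det_on {..<N} F"
proof -
  have "(\<Prod>i = 0..<N. mat N N (\<lambda>(i, j). F i j) $$ (i, p i)) = (\<Prod>i = 0..<N. F i (p i))"
    if "p permutes {0..<N}" for p
    using permutes_in_image[OF that] by (intro prod.cong) auto
  then show ?thesis
    by (subst det_def'[of _ N]) (auto simp: det_on_def lessThan_atLeast0 intro!: sum.cong)
qed

lemma det_on_cong:
  assumes "\<And>i j. i \<in> S \<Longrightarrow> j \<in> S \<Longrightarrow> F i j = G i j"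
  shows "det_on S F = det_on S G"
  unfolding det_on_def
  by (intro sum.cong arg_cong2[where f = "(*)"] prod.cong)
     (auto intro!: assms simp: permutes_in_image)

text \<open>Simultaneous renumbering of rows and columns conjugates every permutation in the Leibniz formula,
  which preserves its sign.\<close>

lemma det_on_reindex:
  assumes f: "bij_betw f T S" and T: "finite T"
  shows "det_on S F = det_on T (\<lambda>i j. F (f i) (f j))"
proof -
  have inj: "inj_on f T" and ST: "S = f ` T"
    using f by (auto simp: bij_betw_def)
  have "(\<lambda>\<pi> x. if x \<in> S then f (\<pi> (inv_into T f x)) else x) = map_permutation T f"
    by (auto simp: fun_eq_iff map_permutation_def restrict_id_def ST)
  then have "bij_betw (map_permutation T f) {\<pi>. \<pi> permutes T} {\<pi>. \<pi> permutes S}"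
    using bij_betw_permutations[OF f] by (simp only:)
  then have "det_on S F = (\<Sum>\<pi> | \<pi> permutes T. signof (map_permutation T f \<pi>) *
      (\<Prod>i\<in>S. F i (map_permutation T f \<pi> i)))"
    unfolding det_on_def by (rule sum.reindex_bij_betw[symmetric])
  also have "\<dots> = det_on T (\<lambda>i j. F (f i) (f j))"
    unfolding det_on_def
  proof (intro sum.cong refl)
    fix \<pi> assume "\<pi> \<in> {\<pi>. \<pi> permutes T}"
    then have \<pi>: "\<pi> permutes T" by simp
    have "(\<Prod>i\<in>S. F i (map_permutation T f \<pi> i)) = (\<Prod>i\<in>T. F (f i) (f (\<pi> i)))"
      unfolding ST by (subst prod.reindex[OF inj]) (simp add: map_permutation_apply[OF inj])
    then show "signof (map_permutation T f \<pi>) * (\<Prod>i\<in>S. F i (map_permutation T f \<pi> i)) =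
        signof \<pi> * (\<Prod>i\<in>T. F (f i) (f (\<pi> i)))"
      unfolding sign_map_permutation[OF inj \<pi> T] by (rule arg_cong)
  qed
  finally show ?thesis .
qed

lemma bij_betw_pick:
  assumes "finite S"
  shows "bij_betw (pick S) {..<card S} S"
proof -
  have "inj_on (pick S) {..<card S}"
    by (rule linorder_inj_onI) (auto dest!: pick_mono_le)
  moreover have "pick S ` {..<card S} \<subseteq> S"
    using pick_in_set_le by auto
  ultimately show ?thesis
    using assms by (simp add: bij_betw_def card_image card_subset_eq)
qed

lemma det_submatrix_eq_det_on:
  assumes "A \<in> carrier_mat n n" and "S \<subseteq> {..<n}"
  shows "det (submatrix A S S) = det_on S (\<lambda>i j. A $$ (i, j))"
proof -
  have "{i. i < n \<and> i \<in> S} = S" using assms(2) by auto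
  then have "submatrix A S S = mat (card S) (card S) (\<lambda>(i, j). A $$ (pick S i, pick S j))"
    using assms(1) by (simp add: submatrix_def)
  then show ?thesis
    by (simp add: det_mat_eq_det_on
      det_on_reindex[OF bij_betw_pick[OF finite_subset[OF assms(2)]]])
qed

lemma det_on_hom:
  assumes "comm_ring_hom h"
  shows "det_on S (\<lambda>i j. h (F i j)) = h (det_on S F)"
proof -
  interpret comm_ring_hom h by fact
  show ?thesis by (simp add: det_on_def hom_distribs)
qed

lemma det_on_smult:
  "det_on S (\<lambda>i j. c * F i j) = c ^ card S * det_on S F"
  by (simp add: det_on_def prod.distrib sum_distrib_left mult.left_commute)

text \<open>Every entry is a sum of a diagonal part and a general part. Multiplying out the Leibniz product,
  with \<open>S\<close> the set of rows where the general part is chosen, the diagonal part vanishes unless the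
  permutation fixes every index outside \<open>S\<close>; the remaining permutations are those of \<open>S\<close>, and they
  assemble to the principal minor on \<open>S\<close>.\<close>

lemma det_on_diagonal_plus:
  assumes "finite N"
  shows "det_on N (\<lambda>i j. (if i = j then z i else 0) + F i j) =
    (\<Sum>S\<in>Pow N. (\<Prod>i\<in>N - S. z i) * det_on S F)"
proof -
  have "det_on N (\<lambda>i j. (if i = j then z i else 0) + F i j) =
    (\<Sum>p | p permutes N. \<Sum>S\<in>Pow N. signof p *
       ((\<Prod>i\<in>S. F i (p i)) * (\<Prod>i\<in>N - S. if i = p i then z i else 0)))"
    unfolding det_on_def sum_distrib_left[symmetric]
    by (subst add.commute, subst prod_add[OF assms]) simp
  also have "\<dots> = (\<Sum>S\<in>Pow N. \<Sum>p | p permutes N. signof p *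
       ((\<Prod>i\<in>S. F i (p i)) * (\<Prod>i\<in>N - S. if i = p i then z i else 0)))"
    by (rule sum.swap)
  also have "\<dots> = (\<Sum>S\<in>Pow N. (\<Prod>i\<in>N - S. z i) * det_on S F)"
  proof (intro sum.cong refl)
    fix S assume "S \<in> Pow N"
    then have S: "S \<subseteq> N" by simp
    have "(\<Sum>p | p permutes N. signof p *
        ((\<Prod>i\<in>S. F i (p i)) * (\<Prod>i\<in>N - S. if i = p i then z i else 0))) =
      (\<Sum>p | p permutes S. signof p *
        ((\<Prod>i\<in>S. F i (p i)) * (\<Prod>i\<in>N - S. if i = p i then z i else 0)))"
    proof (rule sum.mono_neutral_right)
      show "finite {p. p permutes N}" using assms by (rule finite_permutations)
      show "{p. p permutes S} \<subseteq> {p. p permutes N}" using S by (auto intro: permutes_subset)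
      show "\<forall>p\<in>{p. p permutes N} - {p. p permutes S}. signof p *
        ((\<Prod>i\<in>S. F i (p i)) * (\<Prod>i\<in>N - S. if i = p i then z i else 0)) = 0"
      proof
        fix p assume "p \<in> {p. p permutes N} - {p. p permutes S}"
        then have "\<exists>i\<in>N - S. i \<noteq> p i"
          using permutes_superset[of p N S] by fastforce
        then have "(\<Prod>i\<in>N - S. if i = p i then z i else 0) = 0"
          using assms by (intro prod_zero) auto
        then show "signof p *
          ((\<Prod>i\<in>S. F i (p i)) * (\<Prod>i\<in>N - S. if i = p i then z i else 0)) = 0" by simp
      qed
    qed
    also have "\<dots> = (\<Sum>p | p permutes S. signof p * ((\<Prod>i\<in>S. F i (p i)) * (\<Prod>i\<in>N - S. z i)))"
      by (intro sum.cong refl arg_cong2[where f = "(*)"] prod.cong) (auto simp: permutes_not_in)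
    also have "\<dots> = (\<Prod>i\<in>N - S. z i) * det_on S F"
      by (simp add: det_on_def sum_distrib_left mult.left_commute mult.commute)
    finally show "(\<Sum>p | p permutes N. signof p *
        ((\<Prod>i\<in>S. F i (p i)) * (\<Prod>i\<in>N - S. if i = p i then z i else 0))) =
      (\<Prod>i\<in>N - S. z i) * det_on S F" .
  qed
  finally show ?thesis .
qed

section \<open>Coefficients of the characteristic polynomial of a pencil\<close>

text \<open>In \<open>det (x I - A - t B)\<close> with \<open>A\<close> diagonal, the diagonal part of row \<open>i\<close> is \<open>x - \<alpha> i\<close> and the
  remaining part is \<open>- t\<close> times row \<open>i\<close> of \<open>B\<close>. The previous expansion gives a factor \<open>- t\<close> for each
  index in \<open>S\<close>; multiplying out the product of the \<open>x - \<alpha> i\<close> over the other indices, with \<open>U\<close> the set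
  of those that contribute \<open>- \<alpha> i\<close>, gives \<open>x\<close> to the power \<open>n - |S| - |U|\<close>. Hence the power of \<open>t\<close>
  fixes \<open>|S|\<close>, and then the power of \<open>x\<close> fixes \<open>|U|\<close>.\<close>

lemma pencil_coeff_diagonal:
  assumes B: "B \<in> carrier_mat n n" and je: "j + e \<le> n"
  shows "pencil_coeff (mat_diag n \<alpha>) B (j, e) =
    (-1) ^ (n - e) * (\<Sum>U | U \<subseteq> {..<n} \<and> card U = n - j - e. (\<Prod>i\<in>U. \<alpha> i) *
      (\<Sum>S | S \<subseteq> {..<n} - U \<and> card S = j. det_on S (\<lambda>i k. B $$ (i, k))))"
proof -
  \<comment> \<open>The scalars, the indeterminate of the coefficients and the outer indeterminate, all inside
    the ring of bivariate polynomials.\<close>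
  define h :: "real \<Rightarrow> real poly poly" where "h = (\<lambda>b. [:[:b:]:])"
  define t :: "real poly poly" where "t = [:[:0, 1:]:]"
  define x :: "real poly poly" where "x = [:0, 1:]"
  let ?N = "{..<n}"
  let ?b = "\<lambda>S. det_on S (\<lambda>i k. B $$ (i, k))"
  interpret h: comm_ring_hom h
    by unfold_locales (auto simp: h_def)
  have tp: "t ^ k = [:monom 1 k:]" for k
    by (induction k) (auto simp: t_def monom_Suc monom_0)
  have monom: "h v * (t ^ k * x ^ l) = monom (monom v k) l" for v k l
    by (simp add: tp x_def h_def monom_altdef smult_monom)
  let ?term = "\<lambda>S U. monom (monom ((-1) ^ (card S + card U) * (\<Prod>i\<in>U. \<alpha> i) * ?b S) (card S))
      (n - card S - card U)"
  have "char_poly_matrix (map_mat (\<lambda>c. [:c:]) (mat_diag n \<alpha>) + [:0, 1:] \<cdot>\<^sub>m map_mat (\<lambda>c. [:c:]) B) =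
    mat n n (\<lambda>(i, k). (if i = k then x - h (\<alpha> i) else 0) + (- t) * h (B $$ (i, k)))"
    using B by (intro eq_matI) (auto simp: char_poly_matrix_def mat_diag_def x_def h_def t_def)
  then have "pencil_char_poly (mat_diag n \<alpha>) B =
      (\<Sum>S\<in>Pow ?N. (\<Prod>i\<in>?N - S. x - h (\<alpha> i)) * ((- t) ^ card S * h (?b S)))"
    by (simp only: pencil_char_poly_def char_poly_def det_mat_eq_det_on
      det_on_diagonal_plus[OF finite_lessThan] det_on_smult det_on_hom[OF h.comm_ring_hom_axioms])
  also have "\<dots> = (\<Sum>S\<in>Pow ?N. \<Sum>U\<in>Pow (?N - S). ?term S U)"
  proof (intro sum.cong refl)
    fix S assume "S \<in> Pow ?N"
    then have S: "S \<subseteq> ?N" "finite S" by (auto intro: finite_subset)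
    have "(\<Prod>i\<in>?N - S. x - h (\<alpha> i)) = (\<Prod>i\<in>?N - S. h (- \<alpha> i) + x)"
      by (simp add: h.hom_uminus)
    also have "\<dots> = (\<Sum>U\<in>Pow (?N - S). (\<Prod>i\<in>U. h (- \<alpha> i)) * (\<Prod>i\<in>?N - S - U. x))"
      by (rule prod_add) simp
    also have "\<dots> = (\<Sum>U\<in>Pow (?N - S). h ((-1) ^ card U * (\<Prod>i\<in>U. \<alpha> i)) * x ^ (n - card S - card U))"
    proof (intro sum.cong refl arg_cong2[where f = "(*)"])
      fix U assume "U \<in> Pow (?N - S)"
      then have U: "U \<subseteq> ?N - S" by simp
      show "(\<Prod>i\<in>U. h (- \<alpha> i)) = h ((-1) ^ card U * (\<Prod>i\<in>U. \<alpha> i))"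
        by (simp add: h.hom_prod[symmetric] prod_uminus)
      show "(\<Prod>i\<in>?N - S - U. x) = x ^ (n - card S - card U)"
        using S U by (simp add: card_Diff_subset finite_subset)
    qed
    finally have "(\<Prod>i\<in>?N - S. x - h (\<alpha> i)) * ((- t) ^ card S * h (?b S)) =
      (\<Sum>U\<in>Pow (?N - S). h ((-1) ^ card U * (\<Prod>i\<in>U. \<alpha> i)) * x ^ (n - card S - card U) *
         ((- t) ^ card S * h (?b S)))"
      by (simp add: sum_distrib_right)
    also have "\<dots> = (\<Sum>U\<in>Pow (?N - S). ?term S U)"
    proof (intro sum.cong refl)
      fix U
      have "h ((-1) ^ card U * (\<Prod>i\<in>U. \<alpha> i)) * x ^ (n - card S - card U) * ((- t) ^ card S * h (?b S))
        = h ((-1) ^ (card S + card U) * (\<Prod>i\<in>U. \<alpha> i) * ?b S) * (t ^ card S * x ^ (n - card S - card U))"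
        by (subst power_minus)
          (simp only: power_add h.hom_mult h.hom_power h.hom_uminus h.hom_one mult_ac)
      then show "h ((-1) ^ card U * (\<Prod>i\<in>U. \<alpha> i)) * x ^ (n - card S - card U) * ((- t) ^ card S * h (?b S))
        = ?term S U" by (simp only: monom)
    qed
    finally show "(\<Prod>i\<in>?N - S. x - h (\<alpha> i)) * ((- t) ^ card S * h (?b S)) =
        (\<Sum>U\<in>Pow (?N - S). ?term S U)" .
  qed
  also have "\<dots> = (\<Sum>(S, U) \<in> (SIGMA S:Pow ?N. Pow (?N - S)). ?term S U)"
    by (rule sum.Sigma) auto
  also have "\<dots> = (\<Sum>(U, S) \<in> (SIGMA U:Pow ?N. Pow (?N - U)). ?term S U)"
    by (rule sum.reindex_bij_witness[of _ prod.swap prod.swap]) auto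
  finally have "pencil_coeff (mat_diag n \<alpha>) B (j, e) =
      (\<Sum>(U, S) \<in> (SIGMA U:Pow ?N. Pow (?N - U)). coeff (coeff (?term S U) e) j)"
    by (simp add: pencil_coeff_def coeff_sum case_prod_unfold)
  also have "\<dots> = (\<Sum>(U, S) \<in> (SIGMA U:{U. U \<subseteq> ?N \<and> card U = n - j - e}. {S. S \<subseteq> ?N - U \<and> card S = j}).
      (-1) ^ (n - e) * ((\<Prod>i\<in>U. \<alpha> i) * ?b S))"
  proof (rule sum.mono_neutral_cong_right)
    have le: "card S + card U \<le> n" if "U \<subseteq> ?N" "S \<subseteq> ?N - U" for U S
    proof -
      have "card S + card U = card (S \<union> U)"
        using that by (intro card_Un_disjoint[symmetric]) (auto intro: finite_subset)
      also have "\<dots> \<le> card ?N" using that by (intro card_mono) auto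
      finally show ?thesis by simp
    qed
    have vanish: "coeff (coeff (?term S U) e) j = 0"
      if US: "U \<subseteq> ?N" "S \<subseteq> ?N - U" and "\<not> (card U = n - j - e \<and> card S = j)" for U S
    proof -
      have "\<not> (n - card S - card U = e \<and> card S = j)"
        using le[OF US] that(3) by linarith
      then show ?thesis by (auto simp: coeff_monom)
    qed
    show "\<forall>y\<in>(SIGMA U:Pow ?N. Pow (?N - U)) -
        (SIGMA U:{U. U \<subseteq> ?N \<and> card U = n - j - e}. {S. S \<subseteq> ?N - U \<and> card S = j}).
        (case y of (U, S) \<Rightarrow> coeff (coeff (?term S U) e) j) = 0"
    proof
      fix y assume y: "y \<in> (SIGMA U:Pow ?N. Pow (?N - U)) -
        (SIGMA U:{U. U \<subseteq> ?N \<and> card U = n - j - e}. {S. S \<subseteq> ?N - U \<and> card S = j})"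
      obtain U S where "y = (U, S)" by (cases y)
      then show "(case y of (U, S) \<Rightarrow> coeff (coeff (?term S U) e) j) = 0"
        using vanish[of U S] y by (simp del: coeff_monom)
    qed
    show "(case y of (U, S) \<Rightarrow> coeff (coeff (?term S U) e) j) =
        (case y of (U, S) \<Rightarrow> (-1) ^ (n - e) * ((\<Prod>i\<in>U. \<alpha> i) * ?b S))"
      if "y \<in> (SIGMA U:{U. U \<subseteq> ?N \<and> card U = n - j - e}. {S. S \<subseteq> ?N - U \<and> card S = j})" for y
      using that je by (auto simp: coeff_monom)
  qed auto
  also have "\<dots> = (-1) ^ (n - e) * (\<Sum>U | U \<subseteq> ?N \<and> card U = n - j - e. (\<Prod>i\<in>U. \<alpha> i) *
      (\<Sum>S | S \<subseteq> ?N - U \<and> card S = j. ?b S))"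
    by (subst sum.Sigma[symmetric]) (auto simp: sum_distrib_left)
  finally show ?thesis .
qed

section \<open>Saddle-point determinants\<close>

text \<open>The matrix on the left is the one on the right, multiplied by \<open>diag (1, W)\<close> from the left and by its
  transpose from the right.\<close>

lemma det_saddle_congruence:
  fixes P J W E :: "'a :: idom mat"
  assumes P: "P \<in> carrier_mat k k" and J: "J \<in> carrier_mat s k"
    and W: "W \<in> carrier_mat s s" and E: "E \<in> carrier_mat s s"
  shows "det (four_block_mat P (transpose_mat (W * J)) (W * J) (W * E * transpose_mat W)) =
    (det W)\<^sup>2 * det (four_block_mat P (transpose_mat J) J E)"
proof -
  let ?L = "four_block_mat (1\<^sub>m k) (0\<^sub>m k s) (0\<^sub>m s k) W"
  let ?M = "four_block_mat P (transpose_mat J) J E"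
  let ?R = "four_block_mat (1\<^sub>m k) (0\<^sub>m k s) (0\<^sub>m s k) (transpose_mat W)"
  note carrier = P J W E
  have LMR: "?L \<in> carrier_mat (k + s) (k + s)" "?M \<in> carrier_mat (k + s) (k + s)"
      "?R \<in> carrier_mat (k + s) (k + s)"
    using carrier by auto
  have LM: "?L * ?M = four_block_mat P (transpose_mat J) (W * J) (W * E)"
    using carrier by (subst mult_four_block_mat[of _ k k _ s _ s _ _ k _ s]) auto
  have "?L * ?M * ?R =
      four_block_mat P (transpose_mat J * transpose_mat W) (W * J) (W * E * transpose_mat W)"
    unfolding LM using carrier by (subst mult_four_block_mat[of _ k k _ s _ s _ _ k _ s]) auto
  also have "transpose_mat J * transpose_mat W = transpose_mat (W * J)"
    by (rule transpose_mult[OF W J, symmetric])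
  finally have "det (four_block_mat P (transpose_mat (W * J)) (W * J) (W * E * transpose_mat W)) =
      det (?L * ?M * ?R)" by simp
  also have "\<dots> = det ?L * det ?M * det ?R"
    using det_mult[OF mult_carrier_mat[OF LMR(1,2)] LMR(3)] det_mult[OF LMR(1,2)] by simp
  also have "det ?L = det W"
    using carrier by (subst det_four_block_mat_upper_right_zero[of _ k _ s]) auto
  also have "det ?R = det W"
    using carrier by (subst det_four_block_mat_upper_right_zero[of _ k _ s]) (auto simp: det_transpose[of _ s])
  finally show ?thesis by (simp add: power2_eq_square)
qed

lemma det_mat_diag: "det (mat_diag n f) = (\<Prod>i<n. f i)"
proof -
  have "prod_list (diag_mat (mat_diag n f)) = (\<Prod>i<n. f i)"
    by (simp add: prod_list_diag_prod mat_diag_def lessThan_atLeast0)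
  then show ?thesis
    by (subst det_upper_triangular[of _ n]) (auto simp: mat_diag_def)
qed

text \<open>Here \<open>J\<close> is the \<open>k \<times> k\<close> identity on top of zero rows, and \<open>E\<close> is supported on those rows of \<open>J\<close> that
  vanish. Thus the matrix splits into the block \<open>(P, 1; 1, 0)\<close>, of determinant \<open>(-1)^k\<close>, and
  the diagonal block of the \<open>u i\<close>.\<close>

lemma det_saddle_core:
  fixes P :: "'a :: idom mat" and u :: "nat \<Rightarrow> 'a" and r :: nat
  assumes P: "P \<in> carrier_mat k k"
  defines "J \<equiv> mat (k + r) k (\<lambda>(i, j). if i = j then 1 else 0)"
    and "E \<equiv> mat_diag (k + r) (\<lambda>i. if i < k then 0 else u (i - k))"
  shows "det (four_block_mat P (transpose_mat J) J E) = (-1) ^ k * (\<Prod>i<r. u i)"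
proof -
  let ?H = "four_block_mat P (1\<^sub>m k) (1\<^sub>m k) (0\<^sub>m k k)"
  have "four_block_mat P (transpose_mat J) J E =
      four_block_mat ?H (0\<^sub>m (k + k) r) (0\<^sub>m r (k + k)) (mat_diag r u)"
    using P by (intro eq_matI) (auto simp: J_def E_def mat_diag_def, (cases k; simp))
  also have "det \<dots> = det ?H * det (mat_diag r u)"
    using P by (intro det_four_block_mat_upper_right_zero) auto
  also have "det ?H = det (P * 0\<^sub>m k k - 1\<^sub>m k * 1\<^sub>m k)"
    using P by (intro det_four_block_mat) auto
  also have "P * 0\<^sub>m k k - 1\<^sub>m k * 1\<^sub>m k = (- 1) \<cdot>\<^sub>m 1\<^sub>m k"
    using P by (intro eq_matI) auto
  finally show ?thesis by (simp add: det_mat_diag)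
qed

lemma index_mult_diag_mult_transpose:
  assumes X: "X \<in> carrier_mat a b" and Y: "Y \<in> carrier_mat c b" and "i < a" "j < c"
  shows "(X * mat_diag b f * transpose_mat Y) $$ (i, j) = (\<Sum>l<b. X $$ (i, l) * f l * Y $$ (j, l))"
proof -
  have "(X * mat_diag b f * transpose_mat Y) $$ (i, j) =
      (\<Sum>l = 0..<b. (X * mat_diag b f) $$ (i, l) * transpose_mat Y $$ (l, j))"
    using assms by (simp add: scalar_prod_def mat_diag_def)
  also have "\<dots> = (\<Sum>l<b. X $$ (i, l) * f l * Y $$ (j, l))"
    using assms by (simp only: mat_diag_mult_right[OF X] lessThan_atLeast0) (intro sum.cong, auto)
  finally show ?thesis .
qed

text \<open>The idea is to write \<open>Q = W J\<close> and \<open>C diag(u) C\<^sup>T = W E W\<^sup>T\<close> with one square matrix \<open>W\<close>: the columns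
  of \<open>Q\<close>, then those of \<open>C\<close>, padded by zero columns up to width \<open>s\<close>. The congruence above then puts
  \<open>det W\<close> squared in front. If padding occurs this is zero; otherwise the core determinant supplies
  the sign and the product of the \<open>u l\<close>.\<close>

lemma det_saddle:
  fixes P Q C :: "'a :: idom mat"
  assumes P: "P \<in> carrier_mat k k" and Q: "Q \<in> carrier_mat s k"
    and C: "C \<in> carrier_mat s r" and s: "k + r \<le> s"
  shows "det (four_block_mat P (transpose_mat Q) Q (C * mat_diag r u * transpose_mat C)) =
    (if s = k + r
     then (-1) ^ k * (\<Prod>l<r. u l) *
       (det (mat s s (\<lambda>(i, j). if j < k then Q $$ (i, j) else C $$ (i, j - k))))\<^sup>2
     else 0)"
proof -
  define W where "W = mat s s (\<lambda>(i, j).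
    if j < k then Q $$ (i, j) else if j < k + r then C $$ (i, j - k) else 0)"
  define J :: "'a mat" where "J = mat s k (\<lambda>(i, j). if i = j then 1 else 0)"
  define f where "f = (\<lambda>i. if i < k then 0 else if i < k + r then u (i - k) else 0)"
  have W: "W \<in> carrier_mat s s" and J: "J \<in> carrier_mat s k"
    by (simp_all add: W_def J_def)
  have "W * J = Q"
  proof (rule eq_matI)
    fix i j assume "i < dim_row Q" "j < dim_col Q"
    then have ij: "i < s" "j < k" using Q by auto
    then have "(W * J) $$ (i, j) = (\<Sum>l = 0..<s. W $$ (i, l) * J $$ (l, j))"
      using W J by (simp add: scalar_prod_def)
    also have "\<dots> = (\<Sum>l = 0..<s. if l = j then W $$ (i, l) else 0)"
      using ij by (intro sum.cong) (auto simp: J_def)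
    also have "\<dots> = Q $$ (i, j)" using ij s by (simp add: W_def)
    finally show "(W * J) $$ (i, j) = Q $$ (i, j)" .
  qed (use Q W J in auto)
  moreover have "W * mat_diag s f * transpose_mat W = C * mat_diag r u * transpose_mat C"
  proof (rule eq_matI)
    fix i j assume "i < dim_row (C * mat_diag r u * transpose_mat C)"
      "j < dim_col (C * mat_diag r u * transpose_mat C)"
    then have ij: "i < s" "j < s" using C by auto
    have "(W * mat_diag s f * transpose_mat W) $$ (i, j) =
        (\<Sum>l<s. W $$ (i, l) * f l * W $$ (j, l))"
      by (rule index_mult_diag_mult_transpose[OF W W ij])
    also have "\<dots> = (\<Sum>l\<in>(+) k ` {..<r}. W $$ (i, l) * f l * W $$ (j, l))"
    proof (rule sum.mono_neutral_right)
      show "\<forall>l\<in>{..<s} - (+) k ` {..<r}. W $$ (i, l) * f l * W $$ (j, l) = 0"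
      proof
        fix l assume "l \<in> {..<s} - (+) k ` {..<r}"
        moreover have "l \<in> (+) k ` {..<r}" if "k \<le> l" "l < k + r"
          using that by (intro image_eqI[of _ _ "l - k"]) auto
        ultimately have "f l = 0" by (auto simp: f_def)
        then show "W $$ (i, l) * f l * W $$ (j, l) = 0" by simp
      qed
    qed (use s in auto)
    also have "\<dots> = (\<Sum>l<r. C $$ (i, l) * u l * C $$ (j, l))"
      using ij s by (subst sum.reindex) (auto simp: W_def f_def intro!: sum.cong)
    also have "\<dots> = (C * mat_diag r u * transpose_mat C) $$ (i, j)"
      by (rule index_mult_diag_mult_transpose[OF C C ij, symmetric])
    finally show "(W * mat_diag s f * transpose_mat W) $$ (i, j) =
      (C * mat_diag r u * transpose_mat C) $$ (i, j)" .
  qed (use C W in auto)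
  ultimately have det: "det (four_block_mat P (transpose_mat Q) Q (C * mat_diag r u * transpose_mat C)) =
      (det W)\<^sup>2 * det (four_block_mat P (transpose_mat J) J (mat_diag s f))"
    using det_saddle_congruence[OF P J W, of "mat_diag s f"] by simp
  show ?thesis
  proof (cases "s = k + r")
    case True
    have "mat_diag s f = mat_diag (k + r) (\<lambda>i. if i < k then 0 else u (i - k))"
      unfolding True by (intro eq_matI) (auto simp: mat_diag_def f_def)
    then have "det (four_block_mat P (transpose_mat J) J (mat_diag s f)) = (-1) ^ k * (\<Prod>l<r. u l)"
      using det_saddle_core[OF P, of r u] by (simp add: J_def True)
    moreover have "W = mat s s (\<lambda>(i, j). if j < k then Q $$ (i, j) else C $$ (i, j - k))"
      unfolding W_def True by (intro eq_matI) auto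
    ultimately show ?thesis using True det by simp
  next
    case False
    \<comment> \<open>Column \<open>k + r\<close> of \<open>W\<close> is the first padding column, hence zero.\<close>
    have "det (transpose_mat W) = det_on {..<s} (\<lambda>i j. W $$ (j, i))"
      unfolding det_mat_eq_det_on[symmetric] using W by (intro arg_cong[where f = det] eq_matI) auto
    also have "\<dots> = 0"
      unfolding det_on_def
    proof (intro sum.neutral ballI)
      fix p assume "p \<in> {p. p permutes {..<s}}"
      then have "p (k + r) < s"
        using permutes_in_image[of p "{..<s}" "k + r"] False s by auto
      then have "W $$ (p (k + r), k + r) = 0"
        using False s by (simp add: W_def)
      then have "(\<Prod>i<s. W $$ (p i, i)) = 0"
        using False s by (intro prod_zero bexI[of _ "k + r"]) auto
      then show "signof p * (\<Prod>i<s. W $$ (p i, i)) = 0" by simp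
    qed
    finally have "det W = 0" using W by (simp add: det_transpose)
    then show ?thesis using False det by simp
  qed
qed

section \<open>Principal minors of the block matrix\<close>

text \<open>Listing the indices of \<open>K\<close> before those of the second block exhibits the principal minor as a
  saddle-point determinant, whose square factor \<open>W\<close> consists of the rows in \<open>I\<close> of the columns of
  \<open>B21\<close> with index in \<open>K\<close>, followed by all columns of \<open>C\<close>.\<close>

lemma det_on_saddle:
  fixes B11 B21 C :: "'a :: idom mat" and u :: "nat \<Rightarrow> 'a"
  assumes B11: "B11 \<in> carrier_mat p p" and B21: "B21 \<in> carrier_mat m p"
    and C: "C \<in> carrier_mat m r" and K: "K \<subseteq> {..<p}" and I: "I \<subseteq> {..<m}"
    and le: "card K + r \<le> card I"
  defines "B \<equiv> four_block_mat B11 (transpose_mat B21) B21 (C * mat_diag r u * transpose_mat C)"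
  shows "det_on (K \<union> (+) p ` I) (\<lambda>i j. B $$ (i, j)) =
    (if card I = card K + r
     then (-1) ^ card K * (\<Prod>l<r. u l) *
       (det (submatrix (mat_of_cols m (map (col B21) (sorted_list_of_set K) @ cols C))
         I {..<card K + r}))\<^sup>2
     else 0)"
proof -
  \<comment> \<open>\<open>\<kappa>\<close> and \<open>\<iota>\<close> enumerate \<open>K\<close> and \<open>I\<close> increasingly, matching the column order and row order of the
    minor; \<open>f\<close> is the joint enumeration, first \<open>K\<close>, then \<open>I\<close> shifted past the first block.\<close>
  define k where "k = card K"
  define s where "s = card I"
  define \<kappa> where "\<kappa> = (!) (sorted_list_of_set K)"
  define \<iota> where "\<iota> = pick I"
  define f where "f = (\<lambda>i. if i < k then \<kappa> i else p + \<iota> (i - k))"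
  define P where "P = mat k k (\<lambda>(i, j). B11 $$ (\<kappa> i, \<kappa> j))"
  define Q where "Q = mat s k (\<lambda>(i, j). B21 $$ (\<iota> i, \<kappa> j))"
  define C' where "C' = mat s r (\<lambda>(i, j). C $$ (\<iota> i, j))"
  let ?cols = "map (col B21) (sorted_list_of_set K) @ cols C"
  have fin: "finite K" "finite I" using K I by (auto intro: finite_subset)
  have \<kappa>: "bij_betw \<kappa> {..<k} K"
    unfolding \<kappa>_def k_def by (rule bij_betw_nth) (use fin in auto)
  have \<iota>: "bij_betw \<iota> {..<s} I"
    unfolding \<iota>_def s_def by (rule bij_betw_pick[OF fin(2)])
  have \<kappa>_lt: "\<kappa> i < p" if "i < k" for i using bij_betwE[OF \<kappa>] that K by auto
  have \<iota>_lt: "\<iota> i < m" if "i < s" for i using bij_betwE[OF \<iota>] that I by auto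
  have "bij_betw f ({..<k} \<union> {k..<k + s}) (K \<union> (+) p ` I)"
  proof (rule bij_betw_combine)
    show "bij_betw f {..<k} K"
      using \<kappa> by (subst bij_betw_cong[of _ f \<kappa>]) (auto simp: f_def)
    have "bij_betw (\<lambda>i. i - k) {k..<k + s} {..<s}"
      by (rule bij_betw_byWitness[of _ "\<lambda>i. i + k"]) auto
    moreover have "bij_betw ((+) p) I ((+) p ` I)"
      by (intro bij_betw_imageI) auto
    ultimately have "bij_betw ((+) p \<circ> (\<iota> \<circ> (\<lambda>i. i - k))) {k..<k + s} ((+) p ` I)"
      using \<iota> by (intro bij_betw_trans)
    then show "bij_betw f {k..<k + s} ((+) p ` I)"
      by (subst bij_betw_cong[of _ f "(+) p \<circ> (\<iota> \<circ> (\<lambda>i. i - k))"]) (auto simp: f_def)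
    show "K \<inter> (+) p ` I = {}" using K by auto
  qed
  moreover have "{..<k} \<union> {k..<k + s} = {..<k + s}" by auto
  ultimately have f: "bij_betw f {..<k + s} (K \<union> (+) p ` I)" by simp
  have "C' * mat_diag r u * transpose_mat C' =
      mat s s (\<lambda>(i, j). (C * mat_diag r u * transpose_mat C) $$ (\<iota> i, \<iota> j))"
  proof (rule eq_matI)
    fix i j assume "i < dim_row (mat s s (\<lambda>(i, j). (C * mat_diag r u * transpose_mat C) $$ (\<iota> i, \<iota> j)))"
      "j < dim_col (mat s s (\<lambda>(i, j). (C * mat_diag r u * transpose_mat C) $$ (\<iota> i, \<iota> j)))"
    then have ij: "i < s" "j < s" by auto
    have C': "C' \<in> carrier_mat s r" by (simp add: C'_def)
    show "(C' * mat_diag r u * transpose_mat C') $$ (i, j) =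
        mat s s (\<lambda>(i, j). (C * mat_diag r u * transpose_mat C) $$ (\<iota> i, \<iota> j)) $$ (i, j)"
      using ij by (simp add: index_mult_diag_mult_transpose[OF C' C']
        index_mult_diag_mult_transpose[OF C C] \<iota>_lt del: index_mult_mat) (simp add: C'_def)
  qed (auto simp: C'_def)
  then have block: "mat (k + s) (k + s) (\<lambda>(i, j). B $$ (f i, f j)) =
      four_block_mat P (transpose_mat Q) Q (C' * mat_diag r u * transpose_mat C')"
    using B11 B21 C \<kappa>_lt \<iota>_lt
    by (intro eq_matI) (auto simp: B_def P_def Q_def f_def trans_less_add1 simp del: index_mult_mat(1))
  have "det_on (K \<union> (+) p ` I) (\<lambda>i j. B $$ (i, j)) =
      det (four_block_mat P (transpose_mat Q) Q (C' * mat_diag r u * transpose_mat C'))"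
    by (simp add: det_on_reindex[OF f] det_mat_eq_det_on[symmetric] block)
  also have "\<dots> = (if s = k + r
     then (-1) ^ k * (\<Prod>l<r. u l) *
       (det (mat s s (\<lambda>(i, j). if j < k then Q $$ (i, j) else C' $$ (i, j - k))))\<^sup>2
     else 0)"
    using le by (intro det_saddle) (auto simp: P_def Q_def C'_def k_def s_def)
  finally have det: "det_on (K \<union> (+) p ` I) (\<lambda>i j. B $$ (i, j)) = (if s = k + r
     then (-1) ^ k * (\<Prod>l<r. u l) *
       (det (mat s s (\<lambda>(i, j). if j < k then Q $$ (i, j) else C' $$ (i, j - k))))\<^sup>2
     else 0)" .
  have minor: "mat s s (\<lambda>(i, j). if j < k then Q $$ (i, j) else C' $$ (i, j - k)) =
      submatrix (mat_of_cols m ?cols) I {..<k + r}" if "s = k + r"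
  proof -
    have pick: "pick {..<k + r} j = j" if "j < k + r" for j
    proof -
      have "{a \<in> {..<k + r}. a < j} = {..<j}" using that by auto
      then show ?thesis using pick_card_in_set[of j "{..<k + r}"] that by simp
    qed
    have rows: "{i. i < m \<and> i \<in> I} = I" using I by auto
    have len: "length (sorted_list_of_set K) = k" by (simp add: k_def)
    have "{j. j < k + r \<and> j \<in> {..<k + r}} = {..<k + r}" by auto
    then have "submatrix (mat_of_cols m ?cols) I {..<k + r} =
        mat s s (\<lambda>(i, j). mat_of_cols m ?cols $$ (\<iota> i, pick {..<k + r} j))"
      using C that by (simp add: submatrix_def rows len s_def[symmetric] \<iota>_def k_def)
    also have "\<dots> = mat s s (\<lambda>(i, j). if j < k then Q $$ (i, j) else C' $$ (i, j - k))"
      using C B21 that \<iota>_lt \<kappa>_lt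
      by (intro eq_matI) (auto simp: pick mat_of_cols_def nth_append len Q_def C'_def \<kappa>_def k_def[symmetric])
    finally show ?thesis by simp
  qed
  show ?thesis
    using det minor by (simp add: k_def s_def)
qed

lemma sum_squared_minors_maximal:
  assumes "dim_col X = N"
  shows "sum_squared_minors N X =
    (\<Sum>I | I \<subseteq> {..<dim_row X} \<and> card I = N. (det (submatrix X I {..<N}))\<^sup>2)"
proof -
  have "{J. J \<subseteq> {..<N} \<and> card J = N} = {{..<N}}"
    using card_subset_eq[of "{..<N}"] by auto
  then show ?thesis
    unfolding sum_squared_minors_def assms
    by (subst sum.cartesian_product[symmetric]) simp
qed

text \<open>When the diagonal has entries \<open>a k\<close> only at the first \<open>p\<close> positions, a set \<open>U\<close> of diagonal choices
  contributes only if it avoids the zeros, so it is described by its complement \<open>K\<close> in the first block.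
  The indices that remain available to the minors of \<open>B\<close> are \<open>K\<close> and the whole second block. The power
  of \<open>x\<close> is parametrised as \<open>m + \<mu> - j\<close> so that \<open>\<mu>\<close> is the size of \<open>K\<close>.\<close>

lemma pencil_coeff_degenerate_diagonal:
  assumes B: "B \<in> carrier_mat (p + m) (p + m)" and \<mu>: "\<mu> \<le> p" and j: "j \<le> m + \<mu>"
  shows "pencil_coeff (mat_diag (p + m) (\<lambda>k. if k < p then a k else 0)) B (j, m + \<mu> - j) =
    (-1) ^ (p + j + \<mu>) * (\<Sum>K | K \<subseteq> {..<p} \<and> card K = \<mu>. (\<Prod>k\<in>{..<p} - K. a k) *
      (\<Sum>S | S \<subseteq> K \<union> {p..<p + m} \<and> card S = j. det_on S (\<lambda>i k. B $$ (i, k))))"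
proof -
  let ?\<alpha> = "\<lambda>k. if k < p then a k else 0"
  let ?g = "\<lambda>T. \<Sum>S | S \<subseteq> T \<and> card S = j. det_on S (\<lambda>i k. B $$ (i, k))"
  have exponent: "p + j + \<mu> = p + m - (m + \<mu> - j) + 2 * \<mu>"
    using \<mu> j by simp
  have sign: "(-1 :: real) ^ (p + j + \<mu>) = (-1) ^ (p + m - (m + \<mu> - j))"
    unfolding exponent by (simp add: power_add power_mult)
  have size: "p + m - j - (m + \<mu> - j) = p - \<mu>" using j by simp
  have "(\<Sum>U | U \<subseteq> {..<p + m} \<and> card U = p - \<mu>. (\<Prod>i\<in>U. ?\<alpha> i) * ?g ({..<p + m} - U)) =
      (\<Sum>U | U \<subseteq> {..<p} \<and> card U = p - \<mu>. (\<Prod>i\<in>U. ?\<alpha> i) * ?g ({..<p + m} - U))"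
  proof (rule sum.mono_neutral_right)
    show "\<forall>U\<in>{U. U \<subseteq> {..<p + m} \<and> card U = p - \<mu>} - {U. U \<subseteq> {..<p} \<and> card U = p - \<mu>}.
        (\<Prod>i\<in>U. ?\<alpha> i) * ?g ({..<p + m} - U) = 0"
    proof
      fix U assume U: "U \<in> {U. U \<subseteq> {..<p + m} \<and> card U = p - \<mu>} - {U. U \<subseteq> {..<p} \<and> card U = p - \<mu>}"
      then have "\<exists>i\<in>U. ?\<alpha> i = 0" "finite U" by (auto intro: finite_subset)
      then have "(\<Prod>i\<in>U. ?\<alpha> i) = 0" by (intro prod_zero)
      then show "(\<Prod>i\<in>U. ?\<alpha> i) * ?g ({..<p + m} - U) = 0" by simp
    qed
  qed auto
  also have "\<dots> = (\<Sum>K | K \<subseteq> {..<p} \<and> card K = \<mu>. (\<Prod>k\<in>{..<p} - K. a k) * ?g (K \<union> {p..<p + m}))"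
  proof (rule sum.reindex_bij_witness[of _ "\<lambda>K. {..<p} - K" "\<lambda>U. {..<p} - U"])
    fix U assume U: "U \<in> {U. U \<subseteq> {..<p} \<and> card U = p - \<mu>}"
    then have "{..<p + m} - U = ({..<p} - U) \<union> {p..<p + m}" "{..<p} - ({..<p} - U) = U" by auto
    moreover have "(\<Prod>i\<in>U. ?\<alpha> i) = (\<Prod>i\<in>U. a i)"
      using U by (intro prod.cong) auto
    ultimately show "(\<Prod>k\<in>{..<p} - ({..<p} - U). a k) * ?g (({..<p} - U) \<union> {p..<p + m}) =
        (\<Prod>i\<in>U. ?\<alpha> i) * ?g ({..<p + m} - U)" by simp
  qed (use \<mu> in \<open>auto simp: card_Diff_subset finite_subset[of _ "{..<p}"]\<close>)
  finally have sums: "(\<Sum>U | U \<subseteq> {..<p + m} \<and> card U = p - \<mu>. (\<Prod>i\<in>U. ?\<alpha> i) * ?g ({..<p + m} - U)) =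
      (\<Sum>K | K \<subseteq> {..<p} \<and> card K = \<mu>. (\<Prod>k\<in>{..<p} - K. a k) * ?g (K \<union> {p..<p + m}))" .
  have "j + (m + \<mu> - j) \<le> p + m" using \<mu> j by simp
  show ?thesis
    unfolding pencil_coeff_diagonal[OF B \<open>j + (m + \<mu> - j) \<le> p + m\<close>] size sign sums
    by (rule refl)
qed

lemma obtain_block_decomposition:
  fixes S :: "nat set"
  assumes "K \<subseteq> {..<p}" and "S \<subseteq> K \<union> {p..<p + m}"
  obtains L I where "L \<subseteq> K" and "I \<subseteq> {..<m}" and "S = L \<union> (+) p ` I"
proof
  show "S \<inter> K \<subseteq> K" by simp
  show "(\<lambda>i. i - p) ` (S \<inter> {p..}) \<subseteq> {..<m}"
    using assms by fastforce
  have "(+) p ` (\<lambda>i. i - p) ` (S \<inter> {p..}) = S \<inter> {p..}"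
    by (force simp: image_image)
  then show "S = (S \<inter> K) \<union> (+) p ` (\<lambda>i. i - p) ` (S \<inter> {p..})"
    using assms by auto
qed

lemma card_block_union:
  fixes L I :: "nat set"
  assumes "L \<subseteq> {..<p}" and "finite I"
  shows "card (L \<union> (+) p ` I) = card L + card I"
proof -
  have "L \<inter> (+) p ` I = {}" "finite L"
    using assms(1) by (auto intro: finite_subset)
  then show ?thesis
    using assms(2) by (simp add: card_Un_disjoint card_image)
qed

text \<open>For a summand that vanishes on every set that misses part of \<open>K\<close>, only sets \<open>S\<close> that contain \<open>K\<close>
  matter, and such a set is determined by its part \<open>I\<close> in the second block.\<close>

lemma sum_subsets_containing:
  fixes g :: "nat set \<Rightarrow> 'a :: comm_monoid_add"
  assumes K: "K \<subseteq> {..<p}"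
    and zero: "\<And>L I. L \<subset> K \<Longrightarrow> I \<subseteq> {..<m} \<Longrightarrow> card L + card I = card K + s \<Longrightarrow> g (L \<union> (+) p ` I) = 0"
  shows "(\<Sum>S | S \<subseteq> K \<union> {p..<p + m} \<and> card S = card K + s. g S) =
    (\<Sum>I | I \<subseteq> {..<m} \<and> card I = s. g (K \<union> (+) p ` I))"
proof -
  have fin: "finite K" using K by (rule finite_subset) simp
  have card: "card (L \<union> (+) p ` I) = card L + card I" if "L \<subseteq> K" "I \<subseteq> {..<m}" for L I
    using that K by (intro card_block_union) (auto intro: finite_subset)
  let ?F = "\<lambda>I. K \<union> (+) p ` I"
  let ?J = "{I. I \<subseteq> {..<m} \<and> card I = s}"
  have "(\<Sum>S | S \<subseteq> K \<union> {p..<p + m} \<and> card S = card K + s. g S) = (\<Sum>S\<in>?F ` ?J. g S)"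
  proof (rule sum.mono_neutral_right)
    show "finite {S. S \<subseteq> K \<union> {p..<p + m} \<and> card S = card K + s}"
      using fin by simp
    show "?F ` ?J \<subseteq> {S. S \<subseteq> K \<union> {p..<p + m} \<and> card S = card K + s}"
      using card[OF order.refl] by auto
    show "\<forall>S\<in>{S. S \<subseteq> K \<union> {p..<p + m} \<and> card S = card K + s} - ?F ` ?J. g S = 0"
    proof
      fix S assume S: "S \<in> {S. S \<subseteq> K \<union> {p..<p + m} \<and> card S = card K + s} - ?F ` ?J"
      then have "S \<subseteq> K \<union> {p..<p + m}" by simp
      from obtain_block_decomposition[OF K this]
      obtain L I where LI: "L \<subseteq> K" "I \<subseteq> {..<m}" "S = L \<union> (+) p ` I" .
      then have "card L + card I = card K + s" using S card by auto
      moreover have "L \<noteq> K" using calculation S LI by auto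
      ultimately show "g S = 0" using zero[of L I] LI by auto
    qed
  qed
  also have "\<dots> = (\<Sum>I\<in>?J. g (?F I))"
  proof (rule sum.reindex_cong[OF _ refl refl])
    show "inj_on ?F ?J"
    proof (rule inj_onI)
      fix I I' assume eq: "?F I = ?F I'"
      have tail: "(+) p ` I'' = ?F I'' \<inter> {p..}" for I'' using K by auto
      have "(+) p ` I = (+) p ` I'"
        using tail[of I] tail[of I'] unfolding eq by (rule trans[OF _ sym])
      then show "I = I'" by (simp add: inj_image_eq_iff)
    qed
  qed
  finally show ?thesis .
qed

section \<open>The four families of coefficients\<close>

lemma sum_principal_minors_mat_diag:
  "sum_principal_minors d (mat_diag n f) = (\<Sum>S | S \<subseteq> {..<n} \<and> card S = d. \<Prod>i\<in>S. f i)"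
  unfolding sum_principal_minors_def
proof (intro sum.cong)
  fix S assume "S \<in> {S. S \<subseteq> {..<n} \<and> card S = d}"
  then have S: "S \<subseteq> {..<n}" "finite S" by (auto intro: finite_subset)
  have pick: "pick S i < n" if "i < card S" for i
    using pick_in_set_le[OF that] S by auto
  have "{i. i < n \<and> i \<in> S} = S" using S by auto
  then have "submatrix (mat_diag n f) S S = mat_diag (card S) (f \<circ> pick S)"
    using pick inj_onD[OF bij_betw_imp_inj_on[OF bij_betw_pick[OF S(2)]]]
    by (intro eq_matI) (auto simp: submatrix_def mat_diag_def)
  then show "det (submatrix (mat_diag n f) S S) = (\<Prod>i\<in>S. f i)"
    using prod.reindex_bij_betw[OF bij_betw_pick[OF S(2)], of f] by (simp add: det_mat_diag)
qed (simp add: mat_diag_def)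

theorem theorem3p6:
  fixes m n r :: nat
    and a u :: "nat \<Rightarrow> real"
    and A B B11 B21 B22 C D :: "real mat"
  assumes "0 < m" and "m < n"
    and "\<And>k. k < n - m \<Longrightarrow> 0 < a k"
    and "A = mat_diag n (\<lambda>k. if k < n - m then a k else 0)"
    and "B \<in> carrier_mat n n" and "transpose_mat B = B"
    and "B11 \<in> carrier_mat (n - m) (n - m)"
    and "B21 \<in> carrier_mat m (n - m)"
    and "B22 \<in> carrier_mat m m"
    and "B = four_block_mat B11 (transpose_mat B21) B21 B22"
    and "r = vec_space.rank m B22"
    and "C \<in> carrier_mat m r"
    and "D = mat_diag r u" and "\<And>k. k < r \<Longrightarrow> u k \<noteq> 0"
    and "B22 = C * D * transpose_mat C"
  shows
    "(\<forall>\<eta> \<in> {0..n - m}.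
        pencil_coeff A B (0, n - \<eta>) = (-1) ^ \<eta> * sum_principal_minors \<eta> A)
     \<and> (\<forall>\<eta> \<in> {1..r}.
        pencil_coeff A B (\<eta>, m - \<eta>) =
          (-1) ^ (n - m + \<eta>) * (\<Prod>k<n - m. a k) * sum_principal_minors \<eta> B22)
     \<and> (\<forall>\<mu> \<in> {1..min (m - r) (n - m)}.
        pencil_coeff A B (r + 2 * \<mu>, m - r - \<mu>) =
          (-1) ^ (n - m + r + 2 * \<mu>) * (\<Prod>k<r. u k) *
          (\<Sum>K | K \<subseteq> {..<n - m} \<and> card K = \<mu>.
             (\<Prod>k \<in> {..<n - m} - K. a k) *
             sum_squared_minors (r + \<mu>)
               (mat_of_cols m (map (col B21) (sorted_list_of_set K) @ cols C))))
     \<and> (\<forall>\<mu> < min (m - r) (n - m). \<forall>\<eta> \<in> {1..m - r - \<mu>}.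
        pencil_coeff A B (r + \<eta> + 2 * \<mu>, m - r - \<eta> - \<mu>) = 0)"
proof -
  define p where "p = n - m"
  have n: "n = p + m" using assms(2) by (simp add: p_def)
  note B = assms(5)[unfolded n] and B11 = assms(7)[folded p_def] and B21 = assms(8)[folded p_def]
    and B22 = assms(9) and B_block = assms(10) and C = assms(12)
  have A: "A = mat_diag (p + m) (\<lambda>k. if k < p then a k else 0)"
    using assms(4) unfolding p_def[symmetric] unfolding n .
  have rm: "r \<le> m"
    using vec_space.rank_le_nc[OF B22] assms(11) by simp
  let ?b = "\<lambda>S. det_on S (\<lambda>i j. B $$ (i, j))"
  let ?X = "\<lambda>K. mat_of_cols m (map (col B21) (sorted_list_of_set K) @ cols C)"
  note coefficient = pencil_coeff_degenerate_diagonal[OF B, of _ _ a, folded A]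
  have minor: "?b (K \<union> (+) p ` I) = (if card I = card K + r
      then (-1) ^ card K * (\<Prod>l<r. u l) * (det (submatrix (?X K) I {..<card K + r}))\<^sup>2 else 0)"
    if "K \<subseteq> {..<p}" "I \<subseteq> {..<m}" "card K + r \<le> card I" for K I
    using det_on_saddle[OF B11 B21 C that, of u] by (simp only: B_block assms(13,15))
  \<comment> \<open>Without a factor \<open>t\<close>, only the empty minor of \<open>B\<close> occurs.\<close>
  have "pencil_coeff A B (0, n - \<eta>) = (-1) ^ \<eta> * sum_principal_minors \<eta> A" if "\<eta> \<le> p" for \<eta>
  proof -
    have "{S. S \<subseteq> {..<p + m} - U \<and> card S = 0} = {{}}" for U
      using finite_subset[of _ "{..<p + m}"] by (auto simp: card_eq_0_iff)
    moreover have "?b {} = 1" by (simp add: det_on_def)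
    ultimately show ?thesis
      using that pencil_coeff_diagonal[OF B, of 0 "p + m - \<eta>"]
      by (simp add: A n sum_principal_minors_mat_diag)
  qed
  \<comment> \<open>With \<open>K\<close> empty, all minors involved lie inside \<open>B22\<close>.\<close>
  moreover have "pencil_coeff A B (\<eta>, m - \<eta>) =
      (-1) ^ (p + \<eta>) * (\<Prod>k<p. a k) * sum_principal_minors \<eta> B22" if "\<eta> \<le> r" for \<eta>
  proof -
    have "{K. K \<subseteq> {..<p} \<and> card K = 0} = {{}}"
      using finite_subset[of _ "{..<p}"] by (auto simp: card_eq_0_iff)
    then have "pencil_coeff A B (\<eta>, m - \<eta>) =
        (-1) ^ (p + \<eta>) * (\<Prod>k<p. a k) * (\<Sum>S | S \<subseteq> {p..<p + m} \<and> card S = \<eta>. ?b S)"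
      using coefficient[of 0 \<eta>] that rm by simp
    also have "(\<Sum>S | S \<subseteq> {p..<p + m} \<and> card S = \<eta>. ?b S) =
        (\<Sum>I | I \<subseteq> {..<m} \<and> card I = \<eta>. ?b ((+) p ` I))"
      using sum_subsets_containing[of "{}" p m \<eta> ?b] by simp
    also have "\<dots> = sum_principal_minors \<eta> B22"
      unfolding sum_principal_minors_def
    proof (intro sum.cong)
      fix I assume "I \<in> {I. I \<subseteq> {..<dim_row B22} \<and> card I = \<eta>}"
      then have I: "I \<subseteq> {..<m}" "finite I" using B22 by (auto intro: finite_subset)
      have "?b ((+) p ` I) = det_on I (\<lambda>i j. B $$ (p + i, p + j))"
        by (rule det_on_reindex[OF _ I(2)]) (auto intro: bij_betw_imageI)
      also have "\<dots> = det_on I (\<lambda>i j. B22 $$ (i, j))"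
        using B11 B22 by (intro det_on_cong) (auto simp: B_block dest!: subsetD[OF I(1)])
      also have "\<dots> = det (submatrix B22 I I)"
        by (rule det_submatrix_eq_det_on[OF B22 I(1), symmetric])
      finally show "?b ((+) p ` I) = det (submatrix B22 I I)" .
    qed (use B22 in auto)
    finally show ?thesis .
  qed
  \<comment> \<open>A set \<open>S\<close> of size \<open>r + 2 |K|\<close> that meets the first block in less than \<open>K\<close> is too large for the
    rank bound, so \<open>S\<close> contains \<open>K\<close> and the saddle-point determinant is in its square case.\<close>
  moreover have "pencil_coeff A B (r + 2 * \<mu>, m - r - \<mu>) = (-1) ^ (p + r + 2 * \<mu>) * (\<Prod>k<r. u k) *
      (\<Sum>K | K \<subseteq> {..<p} \<and> card K = \<mu>. (\<Prod>k \<in> {..<p} - K. a k) * sum_squared_minors (r + \<mu>) (?X K))"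
    if "\<mu> \<le> m - r" "\<mu> \<le> p" for \<mu>
  proof -
    have inner: "(\<Sum>S | S \<subseteq> K \<union> {p..<p + m} \<and> card S = r + 2 * \<mu>. ?b S) =
        (-1) ^ \<mu> * (\<Prod>l<r. u l) * sum_squared_minors (r + \<mu>) (?X K)"
      if K: "K \<subseteq> {..<p}" "card K = \<mu>" for K
    proof -
      have "finite K" using K(1) by (rule finite_subset) simp
      have dims: "dim_row (?X K) = m" "dim_col (?X K) = r + \<mu>"
        using C K by auto
      have "(\<Sum>S | S \<subseteq> K \<union> {p..<p + m} \<and> card S = card K + (r + \<mu>). ?b S) =
          (\<Sum>I | I \<subseteq> {..<m} \<and> card I = r + \<mu>. ?b (K \<union> (+) p ` I))"
      proof (rule sum_subsets_containing[OF K(1)])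
        fix L I assume L: "L \<subset> K" "I \<subseteq> {..<m}" "card L + card I = card K + (r + \<mu>)"
        have "card L < card K"
          by (rule psubset_card_mono[OF \<open>finite K\<close> L(1)])
        then show "?b (L \<union> (+) p ` I) = 0"
          using L K minor[of L I] by auto
      qed
      also have "\<dots> = (\<Sum>I | I \<subseteq> {..<m} \<and> card I = r + \<mu>.
          (-1) ^ \<mu> * (\<Prod>l<r. u l) * (det (submatrix (?X K) I {..<r + \<mu>}))\<^sup>2)"
        using K by (intro sum.cong refl) (auto simp: minor add.commute[of r])
      also have "\<dots> = (-1) ^ \<mu> * (\<Prod>l<r. u l) * sum_squared_minors (r + \<mu>) (?X K)"
        unfolding sum_squared_minors_maximal[OF dims(2)] dims(1) by (simp add: sum_distrib_left)
      finally show ?thesis using K(2) by (simp add: mult_2 add_ac)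
    qed
    have idx: "m + \<mu> - (r + 2 * \<mu>) = m - r - \<mu>" by simp
    have "pencil_coeff A B (r + 2 * \<mu>, m - r - \<mu>) = (-1) ^ (p + (r + 2 * \<mu>) + \<mu>) *
        (\<Sum>K | K \<subseteq> {..<p} \<and> card K = \<mu>. (\<Prod>k\<in>{..<p} - K. a k) *
          (\<Sum>S | S \<subseteq> K \<union> {p..<p + m} \<and> card S = r + 2 * \<mu>. ?b S))"
      using coefficient[of \<mu> "r + 2 * \<mu>"] that rm unfolding idx by simp
    also have "(\<Sum>K | K \<subseteq> {..<p} \<and> card K = \<mu>. (\<Prod>k\<in>{..<p} - K. a k) *
          (\<Sum>S | S \<subseteq> K \<union> {p..<p + m} \<and> card S = r + 2 * \<mu>. ?b S)) =
        (\<Sum>K | K \<subseteq> {..<p} \<and> card K = \<mu>. (\<Prod>k\<in>{..<p} - K. a k) *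
          ((-1) ^ \<mu> * (\<Prod>l<r. u l) * sum_squared_minors (r + \<mu>) (?X K)))"
      by (intro sum.cong refl arg_cong2[where f = "(*)"] inner) auto
    also have "\<dots> = (-1) ^ \<mu> * (\<Prod>l<r. u l) * (\<Sum>K | K \<subseteq> {..<p} \<and> card K = \<mu>.
        (\<Prod>k\<in>{..<p} - K. a k) * sum_squared_minors (r + \<mu>) (?X K))"
      by (simp add: sum_distrib_left mult_ac)
    \<comment> \<open>The sign \<open>(-1) ^ \<mu>\<close> of the determinants cancels against the one in the coefficient.\<close>
    finally show ?thesis
      by (simp add: power_add power_mult power_mult_distrib[symmetric])
  qed
  \<comment> \<open>Now \<open>|S|\<close> exceeds \<open>r + 2 |K|\<close>, so every minor vanishes.\<close>
  moreover have "pencil_coeff A B (r + \<eta> + 2 * \<mu>, m - r - \<eta> - \<mu>) = 0"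
    if "\<mu> < m - r" "\<mu> < p" "1 \<le> \<eta>" "\<eta> \<le> m - r - \<mu>" for \<mu> \<eta>
  proof -
    have idx: "m + \<mu> - (r + \<eta> + 2 * \<mu>) = m - r - \<eta> - \<mu>" by simp
    have zero: "?b S = 0" if K: "K \<subseteq> {..<p}" "card K = \<mu>"
      and S: "S \<subseteq> K \<union> {p..<p + m}" "card S = r + \<eta> + 2 * \<mu>" for K S
    proof -
      obtain L I where L: "L \<subseteq> K" "I \<subseteq> {..<m}" "S = L \<union> (+) p ` I"
        using obtain_block_decomposition[OF K(1) S(1)] .
      have "finite K" using K(1) by (rule finite_subset) simp
      then have "card L \<le> \<mu>" using card_mono L(1) K(2) by blast
      moreover have "card S = card L + card I"
        unfolding L(3) using L K by (intro card_block_union) (auto intro: finite_subset)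
      ultimately show ?thesis
        using minor[of L I] L K S \<open>1 \<le> \<eta>\<close> by auto
    qed
    have "(\<Sum>S | S \<subseteq> K \<union> {p..<p + m} \<and> card S = r + \<eta> + 2 * \<mu>. ?b S) = 0"
      if "K \<subseteq> {..<p}" "card K = \<mu>" for K
      using zero[OF that] by (intro sum.neutral) auto
    then have "(\<Sum>K | K \<subseteq> {..<p} \<and> card K = \<mu>. (\<Prod>k\<in>{..<p} - K. a k) *
        (\<Sum>S | S \<subseteq> K \<union> {p..<p + m} \<and> card S = r + \<eta> + 2 * \<mu>. ?b S)) = 0"
      by (intro sum.neutral ballI) simp
    then show ?thesis
      using coefficient[of \<mu> "r + \<eta> + 2 * \<mu>"] that rm unfolding idx by simp
  qed
  ultimately show ?thesis
    unfolding p_def[symmetric] by simp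
qed

end
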